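(* If $G$ is a connected finite simple bipartite graph whose adjacency matrix has rank $r$, then $E(G)\geq\sqrt{(r+1)^2-5}$.
   Context: The energy $E(G)$ of a graph $G$ is the sum of the absolute values of all eigenvalues of its adjacency matrix. *)

theory Defs
  imports
    "Graph_Theory.Digraph_Component"
    "Jordan_Normal_Form.DL_Rank"
    "Jordan_Normal_Form.Char_Poly"
begin

text \<open>
  A finite simple graph is a symmetric, loop-free digraph without parallel arcs, i.e. a model of
  the locale \<^locale>\<open>graph\<close>; each undirected edge corresponds to a pair of opposite arcs.
\<close>

definition bipartite :: "('a, 'b) pre_digraph \<Rightarrow> bool" where
  "bipartite G \<longleftrightarrow>
     (\<exists>X Y. verts G = X \<union> Y \<and> X \<inter> Y = {} \<and>
        (\<forall>u v. u \<rightarrow>\<^bsub>G\<^esub> v \<longrightarrow> (u \<in> X \<and> v \<in> Y) \<or> (u \<in> Y \<and> v \<in> X)))"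

text \<open>
  Rows and columns are indexed by a list \<open>vs\<close>, meant to enumerate the vertices without repetition.
  Changing the enumeration conjugates the matrix by a permutation matrix.
\<close>

definition adjacency_matrix :: "('a, 'b) pre_digraph \<Rightarrow> 'a list \<Rightarrow> real mat" where
  "adjacency_matrix G vs =
     mat (length vs) (length vs) (\<lambda>(i, j). if vs ! i \<rightarrow>\<^bsub>G\<^esub> vs ! j then 1 else 0)"

definition matrix_rank :: "real mat \<Rightarrow> nat" where
  "matrix_rank A = vec_space.rank (dim_row A) A"

text \<open>
  Eigenvalues are counted with (algebraic) multiplicity and taken in the complex numbers, so that
  none is lost by definition; the adjacency matrix of a graph being symmetric, they are all real.
\<close>

definition graph_energy :: "('a, 'b) pre_digraph \<Rightarrow> 'a list \<Rightarrow> real" where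
  "graph_energy G vs =
     (\<Sum>z\<in>#proots (char_poly (map_mat complex_of_real (adjacency_matrix G vs))). cmod z)"

end

theory Submission
  imports
    Defs
    "Jordan_Normal_Form.Jordan_Normal_Form_Uniqueness"
    "Jordan_Normal_Form.Jordan_Normal_Form_Existence"
begin

text \<open>
  Let the eigenvalues be listed with multiplicity. The adjacency matrix \<open>A\<close> is conjugate to \<open>- A\<close> by
  the diagonal sign matrix of the bipartition, so its spectrum is symmetric; since \<open>A\<close> is symmetric,
  exactly \<open>r\<close> eigenvalues are nonzero. Hence \<open>r = 2k\<close> and the energy is \<open>2(x\<^sub>1 + \<dots> + x\<^sub>k)\<close> for the
  positive eigenvalues \<open>x\<^sub>i\<close>. Their product is at least 1, its square being up to sign the lowest nonzero
  coefficient of an integer polynomial, so the cross terms of \<open>(x\<^sub>1 + \<dots> + x\<^sub>k)\<^sup>2\<close> contribute at least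
  \<open>k(k - 1)\<close> by AM-GM. The squares contribute half of the trace of \<open>A\<^sup>2\<close>, which is the number of edges
  and therefore at least \<open>n - 1 \<ge> 2k - 1\<close> by connectedness, \<open>n\<close> being the number of vertices.
\<close>

section \<open>Real spectrum of a symmetric matrix, and the energy\<close>

text \<open>As the matrix is real, conjugating an eigenvector for \<open>a\<close> gives one for
  \<open>cnj a\<close>. Symmetry moves the matrix across \<open>conjugate v \<bullet> v\<close>, a
  nonzero squared norm, so \<open>cnj a = a\<close>.\<close>

lemma symmetric_real_eigenvalue_real:
  fixes A :: "real mat"
  assumes A: "A \<in> carrier_mat n n" and sym: "transpose_mat A = A"
    and ev: "eigenvalue (map_mat complex_of_real A) a"
  shows "a \<in> \<real>"
proof -
  let ?C = "map_mat complex_of_real A"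
  have C: "?C \<in> carrier_mat n n" using A by simp
  have symC: "transpose_mat ?C = ?C"
    using sym by (metis map_mat_transpose)
  obtain v where v: "v \<in> carrier_vec n" "v \<noteq> 0\<^sub>v n" "?C *\<^sub>v v = a \<cdot>\<^sub>v v"
    using ev A unfolding eigenvalue_def eigenvector_def by auto
  have cv: "conjugate v \<in> carrier_vec n" using v by auto
  have Ccv: "?C *\<^sub>v conjugate v = cnj a \<cdot>\<^sub>v conjugate v"
  proof -
    have "?C *\<^sub>v conjugate v = conjugate (?C *\<^sub>v v)"
      using C v(1) A by (intro eq_vecI) (auto simp: scalar_prod_def)
    also have "\<dots> = conjugate (a \<cdot>\<^sub>v v)" using v by simp
    also have "\<dots> = cnj a \<cdot>\<^sub>v conjugate v" by (intro eq_vecI) auto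
    finally show ?thesis .
  qed
  have "cnj a * (conjugate v \<bullet> v) = (?C *\<^sub>v conjugate v) \<bullet> v"
    using Ccv v(1) cv by simp
  also have "\<dots> = conjugate v \<bullet> (?C *\<^sub>v v)"
    using transpose_vec_mult_scalar[OF C v(1) cv] symC by simp
  also have "\<dots> = a * (conjugate v \<bullet> v)" using v cv by simp
  finally have "cnj a * (conjugate v \<bullet> v) = a * (conjugate v \<bullet> v)" .
  moreover have "conjugate v \<bullet> v \<noteq> 0"
    using v conjugate_square_eq_0_vec[OF v(1)] comm_scalar_prod[OF v(1) cv] by simp
  ultimately show ?thesis by (simp add: Reals_cnj_iff)
qed

text \<open>The characteristic polynomial splits over the complex numbers with real roots only;
  embedding coefficients is injective, so the factorization descends to the reals.\<close>

lemma symmetric_real_char_poly_splits: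
  fixes A :: "real mat"
  assumes A: "A \<in> carrier_mat n n" and sym: "transpose_mat A = A"
  obtains es where "char_poly A = (\<Prod>e\<leftarrow>es. [:- e, 1:])" "length es = n"
proof -
  let ?C = "map_mat complex_of_real A"
  have C: "?C \<in> carrier_mat n n" using A by simp
  obtain as where as: "char_poly ?C = (\<Prod>a\<leftarrow>as. [:- a, 1:])" "length as = n"
    using char_poly_factorized[OF C] by auto
  have real: "of_real (Re a) = a" if "a \<in> set as" for a
  proof -
    have "poly (char_poly ?C) a = 0"
      unfolding as poly_prod_list using that by (auto simp: prod_list_zero_iff image_iff intro!: bexI[of _ a])
    then show ?thesis
      using symmetric_real_eigenvalue_real[OF A sym] eigenvalue_root_char_poly[OF C] by auto
  qed
  interpret oh: map_poly_inj_idom_hom complex_of_real ..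
  have "map_poly of_real (char_poly A) = char_poly ?C"
    using of_real_hom.char_poly_hom[OF A, where ?'a = complex] by simp
  also have "\<dots> = (\<Prod>a\<leftarrow>as. [:- complex_of_real (Re a), 1:])"
    unfolding as using real by (auto cong: map_cong)
  also have "\<dots> = map_poly of_real (\<Prod>e\<leftarrow>map Re as. [:- e, 1:])"
    by (simp add: oh.hom_prod_list o_def)
  finally have "char_poly A = (\<Prod>e\<leftarrow>map Re as. [:- e, 1:])"
    using oh.injectivity by blast
  with as show ?thesis by (intro that[of "map Re as"]) auto
qed

lemma proots_prod_linear:
  fixes as :: "'a::idom list"
  shows "proots (\<Prod>a\<leftarrow>as. [:- a, 1:]) = mset as"
proof (induction as)
  case (Cons a as)
  have "(\<Prod>a\<leftarrow>as. [:- a, 1:]) \<noteq> 0" by (auto simp: prod_list_zero_iff)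
  then have "proots ([:- a, 1:] * (\<Prod>a\<leftarrow>as. [:- a, 1:])) = proots [:- a, 1:] + proots (\<Prod>a\<leftarrow>as. [:- a, 1:])"
    by (intro proots_mult) auto
  then show ?case using Cons by (simp del: mult_pCons_left)
qed simp

lemma graph_energy_eq_sum_abs:
  assumes "char_poly (adjacency_matrix G vs) = (\<Prod>e\<leftarrow>es. [:- e, 1:])"
  shows "graph_energy G vs = (\<Sum>e\<leftarrow>es. \<bar>e\<bar>)"
proof -
  let ?A = "adjacency_matrix G vs"
  interpret oh: map_poly_inj_idom_hom complex_of_real ..
  have A: "?A \<in> carrier_mat (length vs) (length vs)" by (simp add: adjacency_matrix_def)
  have "char_poly (map_mat complex_of_real ?A) = map_poly of_real (char_poly ?A)"
    using of_real_hom.char_poly_hom[OF A] .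
  also have "\<dots> = (\<Prod>a\<leftarrow>map complex_of_real es. [:- a, 1:])"
    unfolding assms by (simp add: oh.hom_prod_list o_def)
  finally have "proots (char_poly (map_mat complex_of_real ?A)) = mset (map complex_of_real es)"
    by (simp only: proots_prod_linear)
  then show ?thesis
    unfolding graph_energy_def
    by (simp add: image_mset.compositionality o_def sum_mset_sum_list flip: mset_map)
qed

section \<open>Trace and negation via triangularization\<close>

lemma sum_diag_mult_comm:
  fixes P Q :: "'a::comm_semiring_0 mat"
  assumes P: "P \<in> carrier_mat n m" and Q: "Q \<in> carrier_mat m n"
  shows "(\<Sum>i<n. (P * Q) $$ (i,i)) = (\<Sum>i<m. (Q * P) $$ (i,i))"
proof -
  have "(\<Sum>i<n. (P * Q) $$ (i,i)) = (\<Sum>i<n. \<Sum>j<m. P $$ (i,j) * Q $$ (j,i))"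
    using P Q by (auto intro!: sum.cong simp: scalar_prod_def atLeast0LessThan)
  also have "\<dots> = (\<Sum>j<m. \<Sum>i<n. Q $$ (j,i) * P $$ (i,j))"
    by (subst sum.swap) (simp add: mult.commute)
  also have "\<dots> = (\<Sum>i<m. (Q * P) $$ (i,i))"
    using P Q by (auto intro!: sum.cong simp: scalar_prod_def atLeast0LessThan)
  finally show ?thesis .
qed

text \<open>Schur decomposition gives \<open>A = P * B * Q\<close> with \<open>B\<close> upper
  triangular and diagonal \<open>es\<close>. Cyclicity of the trace reduces the claim to
  \<open>B * B\<close>, whose diagonal consists of the squares of the diagonal of
  \<open>B\<close>.\<close>

lemma sum_square_eigenvalues:
  fixes A :: "'a::conjugatable_ordered_field mat"
  assumes A: "A \<in> carrier_mat n n"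
    and es: "char_poly A = (\<Prod>e\<leftarrow>es. [:- e, 1:])"
  shows "(\<Sum>e\<leftarrow>es. e\<^sup>2) = (\<Sum>i<n. (A * A) $$ (i,i))"
proof -
  obtain B P Q where schur: "schur_decomposition A es = (B, P, Q)" by (cases "schur_decomposition A es")
  have sim: "similar_mat_wit A B P Q" and B: "upper_triangular B" "diag_mat B = es"
    using schur_decomposition[OF A es schur] by auto
  note w = similar_mat_witD2[OF A sim]
  have "A * A = P * (B * B) * Q"
    using similar_mat_wit_pow_id[OF sim, of 2] A w(5) by (simp add: numeral_2_eq_2)
  then have "(\<Sum>i<n. (A * A) $$ (i,i)) = (\<Sum>i<n. (P * (B * B * Q)) $$ (i,i))"
    using w(5-7) by (simp add: assoc_mult_mat[of _ n n _ n _ n])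
  also have "\<dots> = (\<Sum>i<n. ((B * B * Q) * P) $$ (i,i))"
    using w(5-7) by (intro sum_diag_mult_comm) auto
  also have "B * B * Q * P = B * B"
    using w(2,5-7) assoc_mult_mat[of "B * B" n n Q n P n] by simp
  also have "(\<Sum>i<n. (B * B) $$ (i,i)) = (\<Sum>i<n. (B $$ (i,i))\<^sup>2)"
  proof (rule sum.cong[OF refl])
    fix i assume i: "i \<in> {..<n}"
    have "(B * B) $$ (i,i) = (\<Sum>j<n. B $$ (i,j) * B $$ (j,i))"
      using w(5) i by (auto simp: scalar_prod_def atLeast0LessThan)
    also have "\<dots> = (\<Sum>j<n. if j = i then (B $$ (i,i))\<^sup>2 else 0)"
    proof (rule sum.cong[OF refl])
      fix j assume j: "j \<in> {..<n}"
      \<comment> \<open>Of two mirrored off-diagonal positions one lies below the diagonal.\<close>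
      have "B $$ (i,j) = 0 \<or> B $$ (j,i) = 0" if "j \<noteq> i"
        using B(1) i j w(5) that upper_triangularD[of B] by (cases "j < i") auto
      then show "B $$ (i,j) * B $$ (j,i) = (if j = i then (B $$ (i,i))\<^sup>2 else 0)"
        by (auto simp: power2_eq_square)
    qed
    finally show "(B * B) $$ (i,i) = (B $$ (i,i))\<^sup>2" using i by simp
  qed
  also have "\<dots> = (\<Sum>e\<leftarrow>es. e\<^sup>2)"
    using w(5) unfolding B(2)[symmetric] diag_mat_def
    by (simp add: sum_list_distinct_conv_sum_set o_def atLeast0LessThan)
  finally show ?thesis by simp
qed

text \<open>The matrices \<open>P\<close> and \<open>Q\<close> that triangularize \<open>A\<close>
  also triangularize \<open>- A\<close>, with the diagonal negated.\<close>

lemma char_poly_uminus_linear_factors: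
  fixes A :: "'a::conjugatable_ordered_field mat"
  assumes A: "A \<in> carrier_mat n n"
    and es: "char_poly A = (\<Prod>e\<leftarrow>es. [:- e, 1:])"
  shows "char_poly (- A) = (\<Prod>e\<leftarrow>map uminus es. [:- e, 1:])"
proof -
  obtain B P Q where schur: "schur_decomposition A es = (B, P, Q)" by (cases "schur_decomposition A es")
  have sim: "similar_mat_wit A B P Q" and B: "upper_triangular B" "diag_mat B = es"
    using schur_decomposition[OF A es schur] by auto
  note w = similar_mat_witD2[OF A sim]
  have mB: "- B \<in> carrier_mat n n" using w by simp
  have "similar_mat_wit (- A) (- B) P Q"
    using w by (intro similar_mat_witI[of _ _ n]) auto
  then have "char_poly (- A) = char_poly (- B)"
    by (intro char_poly_similar) (auto simp: similar_mat_def)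
  also have "\<dots> = (\<Prod>e\<leftarrow>diag_mat (- B). [:- e, 1:])"
    using B(1) w by (intro char_poly_upper_triangular[OF mB]) (auto simp: upper_triangular_def)
  also have "diag_mat (- B) = map uminus es"
    using w unfolding B(2)[symmetric] diag_mat_def by auto
  finally show ?thesis .
qed

section \<open>Rank and the multiplicity of the eigenvalue 0\<close>

text \<open>If \<open>A * A\<close> kills \<open>v\<close>, then the squared norm of
  \<open>A *\<^sub>v v\<close> is
  \<open>v \<bullet> (A *\<^sub>v (A *\<^sub>v v)) = 0\<close>.\<close>

lemma symmetric_real_kernel_square:
  fixes A :: "real mat"
  assumes A: "A \<in> carrier_mat n n" and sym: "transpose_mat A = A"
  shows "mat_kernel (A * A) = mat_kernel A"
proof
  show "mat_kernel A \<subseteq> mat_kernel (A * A)" by (rule mat_kernel_mult_subset[OF A A])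
  show "mat_kernel (A * A) \<subseteq> mat_kernel A"
  proof
    fix v assume "v \<in> mat_kernel (A * A)"
    then have v: "v \<in> carrier_vec n" "A * A *\<^sub>v v = 0\<^sub>v n"
      using mat_kernelD[of "A * A" n n v] A by auto
    have Av: "A *\<^sub>v v \<in> carrier_vec n" using A v by simp
    have "(A *\<^sub>v v) \<bullet> (A *\<^sub>v v) = v \<bullet> (A *\<^sub>v (A *\<^sub>v v))"
      using transpose_vec_mult_scalar[OF A Av v(1)] sym by simp
    also have "\<dots> = 0" using v A by simp
    finally have "A *\<^sub>v v = 0\<^sub>v n"
      using conjugate_square_eq_0_vec[OF Av] by simp
    then show "v \<in> mat_kernel A" using A v by (intro mat_kernelI) auto
  qed
qed

lemma kernel_dim_cong:
  assumes "mat_kernel A = mat_kernel B" "dim_col A = dim_col B"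
  shows "kernel_dim A = kernel_dim B"
  using assms unfolding kernel_dim_def by simp

text \<open>Geometric and algebraic multiplicity of 0 agree: since \<open>A\<close> and
  \<open>A * A\<close> have the same kernel, every Jordan block for 0 has size at most 1, so
  counting blocks is the same as adding up their sizes.\<close>

lemma symmetric_real_kernel_dim:
  fixes A :: "real mat"
  assumes A: "A \<in> carrier_mat n n" and sym: "transpose_mat A = A"
    and es: "char_poly A = (\<Prod>e\<leftarrow>es. [:- e, 1:])"
  shows "kernel_dim A = count (mset es) 0"
proof -
  obtain n_as where jnf: "jordan_nf A n_as" using jordan_nf_exists[OF A es] by blast
  define ns where "ns = map fst [(n, e)\<leftarrow>n_as. e = 0]"
  have cm: "char_matrix A 0 = A" using A by (auto simp: char_matrix_def)
  have AA: "A ^\<^sub>m 2 = A * A" using A by (simp add: numeral_2_eq_2)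
  have A1: "A ^\<^sub>m 1 = A" using A by simp
  have "kernel_dim (A * A) = kernel_dim A"
    using A symmetric_real_kernel_square[OF A sym] by (intro kernel_dim_cong) auto
  \<comment> \<open>A nilpotent Jordan block of size \<open>k\<close> contributes
    \<open>min m k\<close> to the kernel dimension of the \<open>m\<close>-th power.\<close>
  moreover have "kernel_dim (A * A) = (\<Sum>k\<leftarrow>ns. min 2 k)"
    using dim_gen_eigenspace[OF jnf, of 0 2] AA by (simp add: dim_gen_eigenspace_def cm ns_def)
  moreover have kA: "kernel_dim A = (\<Sum>k\<leftarrow>ns. min 1 k)"
    using dim_gen_eigenspace[OF jnf, of 0 1] A1 by (simp add: dim_gen_eigenspace_def cm ns_def)
  ultimately have eq: "(\<Sum>k\<leftarrow>ns. min 2 k) = (\<Sum>k\<leftarrow>ns. min 1 k)" by simp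
  \<comment> \<open>Termwise \<open>min 1 k \<le> min 2 k\<close>, so equal sums force equality in
    each term, which excludes \<open>k \<ge> 2\<close>.\<close>
  have le1: "(\<Sum>k\<leftarrow>ks. min 2 k) = (\<Sum>k\<leftarrow>ks. min 1 k) \<Longrightarrow> (\<Sum>k\<leftarrow>ks. min 1 k) = sum_list ks" for ks :: "nat list"
  proof (induction ks)
    case (Cons k ks)
    have "(\<Sum>k\<leftarrow>ks. min 1 k) \<le> (\<Sum>k\<leftarrow>ks. min 2 k)" by (intro sum_list_mono) auto
    with Cons show ?case by (auto simp: min_def split: if_splits)
  qed simp
  have "kernel_dim A = sum_list ns" unfolding kA by (rule le1[OF eq])
  also have "\<dots> = Polynomial.order 0 (char_poly A)"
    unfolding jordan_nf_order[OF jnf] ns_def by (simp add: case_prod_unfold)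
  also have "\<dots> = count (proots (char_poly A)) 0"
    using degree_monic_char_poly[OF A] by (subst count_proots) auto
  finally show ?thesis unfolding es proots_prod_linear .
qed

text \<open>Links the rank, defined through the column span, to the image to which rank-nullity
  applies.\<close>

lemma span_cols_eq_image:
  fixes A :: "'a::field mat"
  assumes A: "A \<in> carrier_mat n nc"
  shows "LinearCombinations.module.span class_ring (module_vec TYPE('a) n) (set (cols A)) = (\<lambda>v. A *\<^sub>v v) ` carrier_vec nc"
proof -
  interpret vec_space "TYPE('a)" n .
  have cols: "set (cols A) \<subseteq> carrier_vec n" using A cols_dim by blast
  have dims: "\<forall>w\<in>set (cols A). dim_vec w = n" using cols by auto
  have m: "mat_of_cols n (cols A) = A" using A by auto
  have l: "length (cols A) = nc" using A by auto
  have "span (set (cols A)) = span_list (cols A)" using span_list_as_span[OF cols] by simp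
  also have "\<dots> = {A *\<^sub>v vec nc c |c. True}"
    unfolding span_list_def lincomb_list_as_mat_mult[OF dims] m l by auto
  also have "\<dots> = (\<lambda>v. A *\<^sub>v v) ` carrier_vec nc"
  proof (safe, goal_cases)
    case (2 x v)
    have "v = vec nc (\<lambda>i. v $ i)" using 2 by auto
    then show ?case by (metis)
  qed auto
  finally show ?thesis .
qed

lemma rank_add_kernel_dim:
  fixes A :: "'a::field mat"
  assumes A: "A \<in> carrier_mat n nc"
  shows "vec_space.rank n A + kernel_dim A = nc"
proof -
  interpret V: vec_space "TYPE('a)" nc .
  interpret W: vec_space "TYPE('a)" n .
  interpret lin: linear_map class_ring V.V W.V "\<lambda>v. A *\<^sub>v v"
    using A by unfold_locales (auto simp: module_hom_def mult_add_distrib_mat_vec mult_mat_vec)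
  have im: "lin.im = W.span (set (cols A))"
    unfolding lin.im_def span_cols_eq_image[OF A] by simp
  have ker: "lin.ker = mat_kernel A"
    unfolding lin.ker_def mat_kernel[OF A] by simp
  have "vectorspace.dim class_ring (W.vs lin.im) + vectorspace.dim class_ring (V.vs lin.ker) = V.dim"
    by (rule lin.rank_nullity) simp
  then show ?thesis
    unfolding im ker W.rank_def kernel_dim_def using A by (simp add: V.dim_is_n)
qed

section \<open>Edge count of a connected graph\<close>

text \<open>A set \<open>S\<close> grows from \<open>{a}\<close> by one vertex at a time. Some pair
  \<open>(x, y)\<close> leaves \<open>S\<close>, and adding \<open>y\<close> brings in both
  \<open>(x, y)\<close> and \<open>(y, x)\<close>, neither of which lies in
  \<open>S \<times> S\<close>.\<close>

lemma connected_sym_relation_card_ge: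
  fixes R :: "('v \<times> 'v) set"
  assumes fin: "finite V" and a: "a \<in> V" and sym: "sym R"
    and conn: "\<And>v. v \<in> V \<Longrightarrow> (a, v) \<in> R\<^sup>*" and RV: "R \<subseteq> V \<times> V"
  shows "2 * (card V - 1) \<le> card R"
proof -
  have "\<exists>S. a \<in> S \<and> S \<subseteq> V \<and> card S = Suc k \<and> 2 * k \<le> card (R \<inter> S \<times> S)" if "k < card V" for k
    using that
  proof (induction k)
    case 0
    then show ?case using a by (intro exI[of _ "{a}"]) auto
  next
    case (Suc k)
    then obtain S where S: "a \<in> S" "S \<subseteq> V" "card S = Suc k" "2 * k \<le> card (R \<inter> S \<times> S)"
      by auto
    have finS: "finite S" using S(2) fin finite_subset by blast
    obtain v where v: "v \<in> V" "v \<notin> S" using S Suc.prems by (metis nat_less_le subsetI subset_antisym)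
    \<comment> \<open>Otherwise \<open>S\<close> would be closed under \<open>R\<close>, hence
      contain everything reachable from \<open>a\<close>, including \<open>v\<close>.\<close>
    have "\<exists>x y. x \<in> S \<and> y \<notin> S \<and> (x, y) \<in> R"
    proof (rule ccontr)
      assume closed: "\<not> ?thesis"
      have "w \<in> S" if "(a, w) \<in> R\<^sup>*" for w
        using that
      proof (induction rule: rtrancl_induct)
        case base
        show ?case by (rule S(1))
      qed (use closed in blast)
      then show False using conn v by blast
    qed
    then obtain x y where xy: "x \<in> S" "y \<notin> S" "(x, y) \<in> R" by blast
    have yx: "(y, x) \<in> R" using xy sym by (simp add: symD)
    have "x \<noteq> y" using xy by blast
    then have "card {(x, y), (y, x)} = 2" by simp
    then have "2 * Suc k \<le> card (R \<inter> S \<times> S) + card {(x, y), (y, x)}" using S by simp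
    also have "\<dots> = card (R \<inter> S \<times> S \<union> {(x, y), (y, x)})"
      using finS xy by (intro card_Un_disjoint[symmetric]) auto
    also have "\<dots> \<le> card (R \<inter> insert y S \<times> insert y S)"
      using finS xy yx by (intro card_mono) auto
    finally show ?case
      using S xy RV finS by (intro exI[of _ "insert y S"]) auto
  qed
  moreover have "card V - 1 < card V" using fin a card_gt_0_iff[of V] by force
  ultimately obtain S where "2 * (card V - 1) \<le> card (R \<inter> S \<times> S)" by blast
  also have "\<dots> \<le> card R"
    using RV fin by (intro card_mono) (auto intro: finite_subset)
  finally show ?thesis .
qed

text \<open>\<open>arcs_ends G\<close> holds both orientations of each edge, hence the factor 2.
  Symmetry turns connectedness into reachability of every vertex from a fixed one.\<close>

lemma (in graph) connected_imp_card_arcs_ends_ge: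
  assumes "Digraph_Component.connected G"
  shows "2 * (card (verts G) - 1) \<le> card (arcs_ends G)"
proof -
  have sc: "strongly_connected G"
    using symmetric_connected_imp_strongly_connected[OF sym_arcs assms] .
  then obtain a where a: "a \<in> verts G" unfolding strongly_connected_def by blast
  have "(a, v) \<in> (arcs_ends G)\<^sup>*" if "v \<in> verts G" for v
    using sc a that unfolding strongly_connected_def reachable_def
    by (auto dest: rtrancl_on_rtranclI)
  then show ?thesis
    using a sym_arcs
    by (intro connected_sym_relation_card_ge[where a = a]) (auto simp: symmetric_def)
qed

text \<open>By symmetry the products in a diagonal entry of \<open>A * A\<close> are again adjacency
  indicators, so the entry is a vertex degree; the degrees add up to the number of ordered adjacent
  pairs.\<close>

lemma sum_diag_adjacency_matrix_square:
  assumes "symmetric G" "distinct vs" "arcs_ends G \<subseteq> set vs \<times> set vs"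
  defines "A \<equiv> adjacency_matrix G vs"
  shows "(\<Sum>i<length vs. (A * A) $$ (i,i)) = card (arcs_ends G)"
proof -
  let ?n = "length vs"
  have bij: "bij_betw (\<lambda>i. vs ! i) {..<?n} (set vs)"
    using assms(2) bij_betw_nth by blast
  have "(\<Sum>i<?n. (A * A) $$ (i,i)) = (\<Sum>i<?n. \<Sum>j<?n. if (vs ! i, vs ! j) \<in> arcs_ends G then 1 else 0)"
    using assms(1) unfolding A_def adjacency_matrix_def
    by (auto intro!: sum.cong simp: scalar_prod_def atLeast0LessThan symmetric_def dest: symD)
  also have "\<dots> = (\<Sum>i<?n. \<Sum>w\<in>set vs. if (vs ! i, w) \<in> arcs_ends G then 1 else 0)"
    by (intro sum.cong refl sum.reindex_bij_betw[OF bij])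
  also have "\<dots> = (\<Sum>v\<in>set vs. \<Sum>w\<in>set vs. if (v, w) \<in> arcs_ends G then 1 else 0)"
    by (rule sum.reindex_bij_betw[OF bij])
  also have "\<dots> = (\<Sum>p\<in>set vs \<times> set vs. if p \<in> arcs_ends G then 1 else 0)"
    by (simp add: sum.cartesian_product case_prod_beta)
  also have "\<dots> = real (card (arcs_ends G))"
    using assms(3) by (simp add: sum.If_cases Int_absorb1 flip: sum.inter_filter)
  finally show ?thesis .
qed

section \<open>Spectral symmetry of bipartite graphs\<close>

lemma bipartite_char_poly_uminus:
  assumes "bipartite G" and "set vs \<subseteq> verts G"
  defines "A \<equiv> adjacency_matrix G vs"
  shows "char_poly (- A) = char_poly A"
proof -
  let ?n = "length vs"
  obtain X Y where XY: "verts G = X \<union> Y" "X \<inter> Y = {}"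
    "\<And>u v. u \<rightarrow>\<^bsub>G\<^esub> v \<Longrightarrow> (u \<in> X \<and> v \<in> Y) \<or> (u \<in> Y \<and> v \<in> X)"
    using assms(1) unfolding bipartite_def by blast
  define s :: "nat \<Rightarrow> real" where "s i = (if vs ! i \<in> X then 1 else -1)" for i
  define D where "D = mat ?n ?n (\<lambda>(i, j). if i = j then s i else 0)"
  have A: "A \<in> carrier_mat ?n ?n" by (simp add: A_def adjacency_matrix_def)
  have D: "D \<in> carrier_mat ?n ?n" by (simp add: D_def)
  have lmult: "(D * M) $$ (i, j) = s i * M $$ (i, j)"
    if "M \<in> carrier_mat ?n ?n" "i < ?n" "j < ?n" for M i j
  proof -
    have "(D * M) $$ (i, j) = (\<Sum>k\<in>{0..<?n}. (if i = k then s i else 0) * M $$ (k, j))"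
      using that by (simp add: D_def scalar_prod_def)
    also have "\<dots> = (\<Sum>k\<in>{0..<?n}. if k = i then s i * M $$ (i, j) else 0)"
      by (intro sum.cong) auto
    finally show ?thesis using that by simp
  qed
  have rmult: "(M * D) $$ (i, j) = M $$ (i, j) * s j"
    if "M \<in> carrier_mat ?n ?n" "i < ?n" "j < ?n" for M i j
  proof -
    have "(M * D) $$ (i, j) = (\<Sum>k\<in>{0..<?n}. M $$ (i, k) * (if k = j then s k else 0))"
      using that by (simp add: D_def scalar_prod_def)
    also have "\<dots> = (\<Sum>k\<in>{0..<?n}. if k = j then M $$ (i, j) * s j else 0)"
      by (intro sum.cong) auto
    finally show ?thesis using that by simp
  qed
  have DD: "D * D = 1\<^sub>m ?n"
  proof (rule eq_matI)
    fix i j assume "i < dim_row (1\<^sub>m ?n :: real mat)" "j < dim_col (1\<^sub>m ?n :: real mat)"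
    then show "(D * D) $$ (i, j) = 1\<^sub>m ?n $$ (i, j)"
      using lmult[OF D, of i j] by (simp add: D_def s_def)
  qed (use D in auto)
  \<comment> \<open>A nonzero entry joins \<open>X\<close> to \<open>Y\<close>, and disjointness
    gives its two ends opposite signs.\<close>
  have neg: "s i * A $$ (i, j) * s j = - A $$ (i, j)" if "i < ?n" "j < ?n" for i j
    using that XY(2) XY(3)[of "vs ! i" "vs ! j"] by (auto simp: A_def adjacency_matrix_def s_def)
  have "- A = D * A * D"
  proof (rule eq_matI)
    fix i j assume "i < dim_row (D * A * D)" "j < dim_col (D * A * D)"
    then have ij: "i < ?n" "j < ?n" using D by auto
    have "(D * A * D) $$ (i, j) = s i * A $$ (i, j) * s j"
      using rmult[OF mult_carrier_mat[OF D A] ij] lmult[OF A ij] by (simp only:)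
    then show "(- A) $$ (i, j) = (D * A * D) $$ (i, j)"
      using A ij neg[OF ij] by (simp only: carrier_matD index_uminus_mat)
  qed (use A D in auto)
  then have "similar_mat_wit (- A) A D D"
    using A D DD by (intro similar_mat_witI[of _ _ ?n]) auto
  then show ?thesis
    by (intro char_poly_similar) (auto simp: similar_mat_def)
qed

section \<open>Sums and products of eigenvalues\<close>

text \<open>The cross terms over ordered pairs of distinct indices must add up to at least
  \<open>k * (k - 1)\<close>. Instead of AM-GM itself, \<open>ln t \<le> t - 1\<close> is summed
  over \<open>t = x i * x j\<close>; the logarithms add up to a multiple of the logarithm of the
  whole product, which is nonnegative.\<close>

lemma square_sum_list_ge:
  fixes xs :: "real list"
  assumes pos: "\<And>x. x \<in> set xs \<Longrightarrow> 0 < x" and prod: "1 \<le> prod_list xs"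
  shows "(\<Sum>x\<leftarrow>xs. x\<^sup>2) + real (length xs) * (real (length xs) - 1) \<le> (sum_list xs)\<^sup>2"
proof -
  define k where "k = length xs"
  define x where "x i = xs ! i" for i
  have xpos: "0 < x i" if "i < k" for i using pos that by (simp add: x_def k_def)
  have "prod_list xs = (\<Prod>i<k. x i)"
    by (simp add: prod.list_conv_set_nth k_def x_def atLeast0LessThan)
  then have "0 \<le> ln (\<Prod>i<k. x i)" using prod by simp
  also have "\<dots> = (\<Sum>i<k. ln (x i))" using xpos by (intro ln_prod) (auto simp: less_le)
  finally have L: "0 \<le> (\<Sum>i<k. ln (x i))" .
  \<comment> \<open>The coefficient is \<open>k - 1\<close> from the \<open>k - 1\<close> choices of
    \<open>j\<close>, less 1 for completing the sum of \<open>ln (x j)\<close> by its term at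
    \<open>i\<close>.\<close>
  have inner: "(\<Sum>j\<in>{..<k}-{i}. ln (x i * x j)) = (real k - 2) * ln (x i) + (\<Sum>j<k. ln (x j))" if "i < k" for i
  proof -
    have "(\<Sum>j\<in>{..<k}-{i}. ln (x i * x j)) = (\<Sum>j\<in>{..<k}-{i}. ln (x i) + ln (x j))"
      using that xpos by (intro sum.cong refl ln_mult_pos) auto
    also have "\<dots> = (real k - 1) * ln (x i) + ((\<Sum>j<k. ln (x j)) - ln (x i))"
      using that by (simp add: sum.distrib sum_diff1 of_nat_diff)
    finally show ?thesis by (simp add: algebra_simps)
  qed
  \<comment> \<open>Each index occurs in \<open>2 * (k - 1)\<close> ordered pairs. For
    \<open>k = 0\<close> this factor is negative, but the sum is empty.\<close>
  have "0 \<le> 2 * (real k - 1) * (\<Sum>i<k. ln (x i))" using L by (cases k) auto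
  also have "\<dots> = (\<Sum>i<k. \<Sum>j\<in>{..<k}-{i}. ln (x i * x j))"
    by (simp add: inner sum.distrib flip: sum_distrib_left) (simp add: algebra_simps)
  also have "\<dots> \<le> (\<Sum>i<k. \<Sum>j\<in>{..<k}-{i}. x i * x j - 1)"
    using xpos by (intro sum_mono ln_le_minus_one) auto
  also have "\<dots> = (\<Sum>i<k. x i * (\<Sum>j<k. x j) - (x i)\<^sup>2 - (real k - 1))"
    by (intro sum.cong refl)
      (simp add: sum_subtractf sum_diff1 of_nat_diff power2_eq_square flip: sum_distrib_left, simp add: algebra_simps)
  also have "\<dots> = (\<Sum>i<k. x i)\<^sup>2 - (\<Sum>i<k. (x i)\<^sup>2) - k * (real k - 1)"
    by (simp add: sum_subtractf power2_eq_square flip: sum_distrib_right)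
  finally have "(\<Sum>i<k. (x i)\<^sup>2) + k * (real k - 1) \<le> (\<Sum>i<k. x i)\<^sup>2" by simp
  then show ?thesis
    by (simp add: sum_list_sum_nth k_def x_def atLeast0LessThan)
qed

text \<open>Negation is a multiplicity-preserving bijection between the positive and the negative
  entries.\<close>

lemma mset_nonzero_uminus_invariant:
  fixes es :: "'a::linordered_idom list"
  assumes sym: "mset (map uminus es) = mset es"
  defines "ps \<equiv> filter (\<lambda>e. 0 < e) es"
  shows "mset [e\<leftarrow>es. e \<noteq> 0] = mset (ps @ map uminus ps)"
proof -
  have "mset (map uminus ps) = image_mset uminus (filter_mset (\<lambda>e. 0 < e) (mset (map uminus es)))"
    unfolding ps_def sym by simp
  also have "\<dots> = filter_mset (\<lambda>e. e < 0) (mset es)"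
    by (simp add: filter_mset_image_mset image_mset.compositionality o_def)
  finally have neg: "mset (map uminus ps) = filter_mset (\<lambda>e. e < 0) (mset es)" .
  have "mset [e\<leftarrow>es. e \<noteq> 0] = filter_mset (\<lambda>e. 0 < e) (mset es) + filter_mset (\<lambda>e. e < 0) (mset es)"
    by (rule multiset_eqI) auto
  then show ?thesis using neg by (simp add: ps_def)
qed

text \<open>After splitting off the power of the variable that belongs to the zero roots, the
  constant coefficient is, up to sign, the product of the other roots. It is a nonzero
  integer.\<close>

lemma abs_prod_nonzero_roots_ge_1:
  fixes p :: "int poly" and es :: "real list"
  assumes "map_poly of_int p = (\<Prod>e\<leftarrow>es. [:- e, 1:])"
  shows "1 \<le> \<bar>prod_list [e\<leftarrow>es. e \<noteq> 0]\<bar>"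
proof -
  define k where "k = length [e\<leftarrow>es. e = 0]"
  define q where "q = (\<Prod>e\<leftarrow>[e\<leftarrow>es. e \<noteq> 0]. [:- e, 1:])"
  have split: "(\<Prod>e\<leftarrow>xs. [:- e, 1:]) = monom 1 (length [e\<leftarrow>xs. e = 0]) * (\<Prod>e\<leftarrow>[e\<leftarrow>xs. e \<noteq> 0]. [:- e, 1:])" for xs :: "real list"
    by (induction xs) (auto simp: monom_Suc mult.left_commute simp del: mult_pCons_left mult_pCons_right)
  have "of_int (coeff p k) = coeff (monom 1 k * q) k"
    using assms split[of es] unfolding k_def q_def by (metis coeff_map_poly of_int_0)
  also have "\<dots> = poly q 0" by (simp add: coeff_monom_mult poly_0_coeff_0)
  also have "\<bar>\<dots>\<bar> = \<bar>prod_list [e\<leftarrow>es. e \<noteq> 0]\<bar>"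
    unfolding q_def by (induction es) (auto simp: abs_mult)
  finally have c: "\<bar>of_int (coeff p k)\<bar> = \<bar>prod_list [e\<leftarrow>es. e \<noteq> 0]\<bar>" by simp
  have "prod_list [e\<leftarrow>es. e \<noteq> 0] \<noteq> 0" by (simp add: prod_list_zero_iff)
  with c have "coeff p k \<noteq> 0" by auto
  then have "1 \<le> \<bar>coeff p k\<bar>" by simp
  then show ?thesis unfolding c[symmetric] by linarith
qed

section \<open>From the spectrum to the energy bound\<close>

theorem theorem4:
  fixes G :: "('a, 'b) pre_digraph" and vs :: "'a list" and r :: nat
  assumes "graph G"
    and "Digraph_Component.connected G"
    and "bipartite G"
    and "distinct vs" and "set vs = verts G"
    and "matrix_rank (adjacency_matrix G vs) = r"
  shows "graph_energy G vs \<ge> sqrt ((real r + 1)\<^sup>2 - 5)"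
proof -
  interpret graph G by (rule assms(1))
  define n where "n = length vs"
  define A where "A = adjacency_matrix G vs"
  have A: "A \<in> carrier_mat n n" by (simp add: A_def adjacency_matrix_def n_def)
  have "vs ! i \<rightarrow>\<^bsub>G\<^esub> vs ! j \<longleftrightarrow> vs ! j \<rightarrow>\<^bsub>G\<^esub> vs ! i" for i j
    using sym_arcs unfolding symmetric_def by (blast dest: symD)
  then have AT: "transpose_mat A = A"
    unfolding A_def adjacency_matrix_def by (intro eq_matI) auto
  obtain es where es: "char_poly A = (\<Prod>e\<leftarrow>es. [:- e, 1:])" "length es = n"
    using symmetric_real_char_poly_splits[OF A AT] by blast
  define nz where "nz = [e\<leftarrow>es. e \<noteq> 0]"
  define ps where "ps = [e\<leftarrow>es. 0 < e]"
  define k where "k = length ps"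

  have "mset (map uminus es) = proots (char_poly (- A))"
    unfolding char_poly_uminus_linear_factors[OF A es(1)] proots_prod_linear ..
  also have "\<dots> = mset es"
    using bipartite_char_poly_uminus[OF assms(3), of vs] assms(5) es(1)
    by (simp add: A_def proots_prod_linear)
  finally have nz: "mset nz = mset (ps @ map uminus ps)"
    unfolding nz_def ps_def by (rule mset_nonzero_uminus_invariant)
  \<comment> \<open>Used with the square for the trace and with the absolute value for the energy;
    \<open>f 0 = 0\<close> discards the zero eigenvalues.\<close>
  have sum_nz: "(\<Sum>e\<leftarrow>es. f e) = (\<Sum>e\<leftarrow>ps. f e) + (\<Sum>e\<leftarrow>ps. f (- e))"
    if "f 0 = 0" for f :: "real \<Rightarrow> real"
  proof -
    have "(\<Sum>e\<leftarrow>es. f e) = (\<Sum>e\<leftarrow>nz. f e)"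
      unfolding nz_def using that by (induction es) auto
    also have "\<dots> = (\<Sum>e\<leftarrow>ps @ map uminus ps. f e)"
      using nz by (metis mset_map sum_mset_sum_list)
    finally show ?thesis by (simp add: o_def)
  qed

  have "vec_space.rank n A + count (mset es) 0 = n"
    using rank_add_kernel_dim[OF A] symmetric_real_kernel_dim[OF A AT es(1)] by simp
  moreover have "count (mset es) 0 + length nz = length es"
    unfolding nz_def by (induction es) auto
  moreover have "length nz = 2 * k"
    using arg_cong[OF nz, of size] by (simp add: k_def)
  moreover have "vec_space.rank n A = r"
    using assms(6) A by (simp add: matrix_rank_def A_def)
  ultimately have r: "r = 2 * k" "2 * k \<le> n" using es(2) by auto

  \<comment> \<open>The same matrix over the integers, so that the characteristic polynomial has
    integer coefficients.\<close>
  define M :: "int mat" where "M = mat n n (\<lambda>(i, j). if vs ! i \<rightarrow>\<^bsub>G\<^esub> vs ! j then 1 else 0)"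
  have "A = map_mat of_int M"
    unfolding A_def adjacency_matrix_def M_def n_def by (intro eq_matI) auto
  then have "map_poly of_int (char_poly M) = (\<Prod>e\<leftarrow>es. [:- e, 1:])"
    using of_int_hom.char_poly_hom[of M n, where ?'a = real] es(1) by (simp add: M_def)
  then have "1 \<le> \<bar>prod_list nz\<bar>"
    unfolding nz_def by (rule abs_prod_nonzero_roots_ge_1)
  also have "prod_list nz = prod_list (ps @ map uminus ps)"
    using nz by (metis prod_mset_prod_list)
  also have "\<bar>\<dots>\<bar> = (prod_list ps)\<^sup>2"
  proof -
    have "\<bar>prod_list (map uminus xs)\<bar> = \<bar>prod_list xs\<bar>" for xs :: "real list"
      by (induction xs) (auto simp: abs_mult)
    then show ?thesis by (simp add: abs_mult power2_eq_square)
  qed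
  finally have sq: "1 \<le> (prod_list ps)\<^sup>2" .
  have pos: "0 < e" if "e \<in> set ps" for e using that by (simp add: ps_def)
  have "0 \<le> prod_list ps" using pos by (intro prod_list_nonneg) (simp add: less_imp_le)
  with sq have "1 \<le> prod_list ps" using power2_le_imp_le[of 1] by simp
  then have "(\<Sum>e\<leftarrow>ps. e\<^sup>2) + real k * (real k - 1) \<le> (sum_list ps)\<^sup>2"
    using square_sum_list_ge[of ps] pos by (simp add: k_def)

  moreover have "2 * (\<Sum>e\<leftarrow>ps. e\<^sup>2) \<ge> 2 * (real n - 1)"
  proof -
    have "card (verts G) = n" using assms(4,5) distinct_card n_def by metis
    moreover have "2 * (\<Sum>e\<leftarrow>ps. e\<^sup>2) = real (card (arcs_ends G))"
    proof -
      have "arcs_ends G \<subseteq> set vs \<times> set vs" 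
        unfolding assms(5) by (rule subrelI) (blast dest: adj_in_verts)
      then show ?thesis
        using sum_diag_adjacency_matrix_square[OF sym_arcs assms(4)] sum_nz[of power2]
          sum_square_eigenvalues[OF A es(1)] by (simp add: A_def n_def)
    qed
    \<comment> \<open>Truncated subtraction is never below real subtraction, so the bound carries
      over.\<close>
    moreover have "2 * (real (card (verts G)) - 1) \<le> real (card (arcs_ends G))"
      using of_nat_mono[OF connected_imp_card_arcs_ends_ge[OF assms(2)], where ?'a = real]
      by (simp add: of_nat_diff_if split: if_splits)
    ultimately show ?thesis by simp
  qed

  moreover have E: "graph_energy G vs = 2 * sum_list ps"
  proof -
    have "graph_energy G vs = (\<Sum>e\<leftarrow>es. \<bar>e\<bar>)"
      using graph_energy_eq_sum_abs es(1) by (simp add: A_def)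
    also have "\<dots> = 2 * (\<Sum>e\<leftarrow>ps. \<bar>e\<bar>)" using sum_nz[of abs] by simp
    also have "map abs ps = ps" using pos by (intro map_idI) force
    finally show ?thesis .
  qed
  \<comment> \<open>The square of the energy is at least
    \<open>4 * (n - 1) + 4 * k * (k - 1)\<close>. With \<open>n \<ge> 2 * k\<close> this is at least
    \<open>4 * k * k + 4 * k - 4\<close>, which equals \<open>(2 * k + 1)^2 - 5\<close>.\<close>
  ultimately have "(real r + 1)\<^sup>2 - 5 \<le> (graph_energy G vs)\<^sup>2"
    using r by (simp add: power2_eq_square algebra_simps)
  moreover have "0 \<le> graph_energy G vs"
    unfolding E using pos by (intro mult_nonneg_nonneg sum_list_nonneg) (auto simp: less_imp_le)
  \<comment> \<open>For \<open>r = 0\<close> the radicand is -4; \<open>sqrt\<close> is monotone on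
    all reals, so this case is covered too.\<close>
  ultimately show ?thesis
    using real_sqrt_le_mono by fastforce
qed

end
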